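(* Let $X$ be a locally convex Hausdorff real topological vector space, let $(f_i)_{i\in I}\subset \Gamma(X)$, let $f=\sum_{i\in I}^{R} f_i$ be the robust sum of the family, and let $\overline{x}^*\in X^*$. Assume that $f$ is proper and weakly inf-locally compact, and that $$\overline{\operatorname{cone}}\,\operatorname{co}\Big\{\Big(\bigcup_{J\in\mathcal F(I)}\sum_{j\in J}\operatorname{dom} f_j^*\Big)-\overline{x}^*\Big\}$$ is a linear subspace of $X^*$. Then the problem $(\mathrm{RP}_{\overline{x}^*})$: $\inf\{f(x)-\langle \overline{x}^*,x\rangle : x\in X\}$ admits at least one optimal solution. More precisely, its optimal solution set $\{x\in X: f(x)-\langle\overline{x}^*,x\rangle=\inf(\mathrm{RP}_{\overline{x}^*})\}$ is the sum of a nonempty convex weakly compact set and a finite-dimensional linear subspace of $X$.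
   Context: $X^*$ is the topological dual of $X$, equipped with the weak$^*$ topology, and $\langle x^*,x\rangle$ is the duality pairing. $I$ is an infinite index set and $\mathcal F(I)$ is the collection of all nonempty finite subsets of $I$. The robust sum of a family $(f_i)_{i\in I}$ of proper functions $f_i:X\to\mathbb R\cup\{+\infty\}$ is $f(x)=\sum_{i\in I}^{R} f_i(x):=\sup_{J\in\mathcal F(I)}\sum_{i\in J} f_i(x)$, $x\in X$. $\Gamma(X)$ is the set of proper closed (lower semicontinuous) convex functions on $X$. For $h:X\to\overline{\mathbb R}$, $\operatorname{dom} h=\{x:h(x)<+\infty\}$ (and similarly on $X^*$), and $h^*(x^* )=\sup_{x\in X}\{\langle x^*,x\rangle-h(x)\}$ is the Fenchel conjugate. A function $f$ is weakly inf-locally compact if each lower level set $\{x\in X: f(x)\le r\}$, $r\in\mathbb R$, is weakly locally compact (locally compact in the topology induced by the weak topology of $X$). $\operatorname{co}A$ is the convex hull of $A$; $\operatorname{cone}A$ is the cone generated by $A\cup\{0\}$, i.e. $\{ta: t\ge 0,\ a\in A\}$ for nonempty $A$; $\overline{\operatorname{cone}}A$ is its closure (weak$^*$ closure in $X^*$). Sums of sets are Minkowski sums. *)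

theory Defs
  imports "HOL-Analysis.Analysis"
begin

text \<open>
  The existing class \<^class>\<open>topological_ab_group_add\<close> provides continuity of addition.
  Convexity is written out, since \<^const>\<open>convex\<close> is not available for the type parameter
  inside a class specification.
\<close>

class locally_convex_hausdorff = topological_ab_group_add + real_vector + t2_space +
  assumes tendsto_scaleR_nhds:
    "((\<lambda>p. fst p *\<^sub>R snd p) \<longlongrightarrow> c *\<^sub>R x) (nhds (c::real) \<times>\<^sub>F nhds x)"
  assumes convex_nhds_zero:
    "eventually (\<lambda>x. x \<in> U) (nhds 0) \<Longrightarrow>
      \<exists>V. (\<forall>x\<in>V. \<forall>y\<in>V. \<forall>u\<ge>0. \<forall>v\<ge>0. u + v = 1 \<longrightarrow> u *\<^sub>R x + v *\<^sub>R y \<in> V)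
        \<and> eventually (\<lambda>x. x \<in> V) (nhds 0) \<and> V \<subseteq> U"

instance real_normed_vector \<subseteq> locally_convex_hausdorff
proof
  fix c :: real and x :: 'a
  show "((\<lambda>p. fst p *\<^sub>R snd p) \<longlongrightarrow> c *\<^sub>R x) (nhds c \<times>\<^sub>F nhds x)"
    by (intro tendsto_scaleR filterlim_fst filterlim_snd)
next
  fix U :: "'a set"
  assume "eventually (\<lambda>x. x \<in> U) (nhds 0)"
  then obtain e where e: "e > 0" "ball 0 e \<subseteq> U"
    unfolding eventually_nhds_metric by (auto simp: subset_eq dist_commute)
  have "eventually (\<lambda>x. x \<in> ball (0::'a) e) (nhds 0)"
    using e by (intro eventually_nhds_in_open) auto
  with e have "\<exists>V. convex V \<and> eventually (\<lambda>x. x \<in> V) (nhds 0) \<and> V \<subseteq> U"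
    by (intro exI [of _ "ball 0 e"]) auto
  then show "\<exists>V. (\<forall>x\<in>V. \<forall>y\<in>V. \<forall>u\<ge>0. \<forall>v\<ge>0. u + v = 1 \<longrightarrow> u *\<^sub>R x + v *\<^sub>R y \<in> V)
      \<and> eventually (\<lambda>x. x \<in> V) (nhds 0) \<and> V \<subseteq> U"
    unfolding convex_def .
qed

typedef (overloaded) 'a dual =
  "{\<phi> :: 'a::locally_convex_hausdorff \<Rightarrow> real. linear \<phi> \<and> continuous_on UNIV \<phi>}"
  morphisms pairing Abs_dual
  by (rule exI [of _ "\<lambda>_. 0"]) (auto simp: linear_iff)

setup_lifting type_definition_dual

instantiation dual :: (locally_convex_hausdorff) real_vector
begin

lift_definition zero_dual :: "'a dual" is "\<lambda>_. 0"
  by (auto simp: linear_iff)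

lift_definition plus_dual :: "'a dual \<Rightarrow> 'a dual \<Rightarrow> 'a dual" is "\<lambda>\<phi> \<psi> x. \<phi> x + \<psi> x"
  by (auto simp: linear_iff algebra_simps intro!: continuous_intros)

lift_definition minus_dual :: "'a dual \<Rightarrow> 'a dual \<Rightarrow> 'a dual" is "\<lambda>\<phi> \<psi> x. \<phi> x - \<psi> x"
  by (auto simp: linear_iff algebra_simps intro!: continuous_intros)

lift_definition uminus_dual :: "'a dual \<Rightarrow> 'a dual" is "\<lambda>\<phi> x. - \<phi> x"
  by (auto simp: linear_iff algebra_simps intro!: continuous_intros)

lift_definition scaleR_dual :: "real \<Rightarrow> 'a dual \<Rightarrow> 'a dual" is "\<lambda>c \<phi> x. c * \<phi> x"
  by (auto simp: linear_iff algebra_simps intro!: continuous_intros)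

instance
  by standard (transfer; simp add: fun_eq_iff algebra_simps)+

end

definition weak_topology :: "'a::locally_convex_hausdorff topology" where
  "weak_topology = topology_generated_by {pairing \<phi> -` U | \<phi> U. open U}"

definition weak_star_topology :: "'a::locally_convex_hausdorff dual topology" where
  "weak_star_topology = topology_generated_by {(\<lambda>\<phi>. pairing \<phi> x) -` U | x U. open U}"

definition finite_dimensional :: "'a::real_vector set \<Rightarrow> bool" where
  "finite_dimensional L \<longleftrightarrow> (\<exists>B. finite B \<and> L = span B)"

definition effective_domain :: "('b \<Rightarrow> ereal) \<Rightarrow> 'b set" where
  "effective_domain h = {x. h x < \<infinity>}"

definition proper_fun :: "('b \<Rightarrow> ereal) \<Rightarrow> bool" where
  "proper_fun h \<longleftrightarrow> effective_domain h \<noteq> {} \<and> (\<forall>x. h x \<noteq> -\<infinity>)"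

definition convex_fun :: "('b::real_vector \<Rightarrow> ereal) \<Rightarrow> bool" where
  "convex_fun h \<longleftrightarrow> convex {(x, r :: real). h x \<le> ereal r}"

definition lower_semicontinuous :: "('b::topological_space \<Rightarrow> ereal) \<Rightarrow> bool" where
  "lower_semicontinuous h \<longleftrightarrow> (\<forall>x. \<forall>a < h x. eventually (\<lambda>y. a < h y) (nhds x))"

definition Gamma_class :: "('a::locally_convex_hausdorff \<Rightarrow> ereal) set" where
  "Gamma_class = {h. proper_fun h \<and> lower_semicontinuous h \<and> convex_fun h}"

definition fenchel_conjugate ::
    "('a::locally_convex_hausdorff \<Rightarrow> ereal) \<Rightarrow> 'a dual \<Rightarrow> ereal" where
  "fenchel_conjugate h \<phi> = (SUP x. ereal (pairing \<phi> x) - h x)"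

definition weakly_inf_locally_compact :: "('a::locally_convex_hausdorff \<Rightarrow> ereal) \<Rightarrow> bool" where
  "weakly_inf_locally_compact h \<longleftrightarrow>
    (\<forall>r :: real. locally_compact_space (subtopology weak_topology {x. h x \<le> ereal r}))"

definition finite_nonempty_subsets :: "'i set \<Rightarrow> 'i set set" where
  "finite_nonempty_subsets I = {J. J \<subseteq> I \<and> finite J \<and> J \<noteq> {}}"

definition robust_sum :: "'i set \<Rightarrow> ('i \<Rightarrow> 'a \<Rightarrow> ereal) \<Rightarrow> 'a \<Rightarrow> ereal" where
  "robust_sum I f x = (SUP J \<in> finite_nonempty_subsets I. \<Sum>i\<in>J. f i x)"

definition cone_gen :: "'b::real_vector set \<Rightarrow> 'b set" where
  "cone_gen A = cone hull (insert 0 A)"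

text \<open>The sums of sets of functionals below are Minkowski sums (\<^theory>\<open>HOL-Library.Set_Algebras\<close>).\<close>

definition conjugate_domain_sums ::
    "'i set \<Rightarrow> ('i \<Rightarrow> 'a::locally_convex_hausdorff \<Rightarrow> ereal) \<Rightarrow> 'a dual set" where
  "conjugate_domain_sums I f =
    (\<Union>J \<in> finite_nonempty_subsets I. \<Sum>j\<in>J. effective_domain (fenchel_conjugate (f j)))"

definition solution_set ::
    "('a::locally_convex_hausdorff \<Rightarrow> ereal) \<Rightarrow> 'a dual \<Rightarrow> 'a set" where
  "solution_set h \<phi> =
    {x. h x - ereal (pairing \<phi> x) = (INF y. h y - ereal (pairing \<phi> y))}"

end

theory Submission
  imports Defs
begin

text \<open>
  By Fenchel--Moreau (via the Hahn--Banach theorem), the robust sum \<open>f\<close> is the supremum of affine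
  functions with slopes in \<open>A = \<Union>\<^sub>J \<Sum>\<^sub>j dom f\<^sub>j\<^sup>*\<close>, and every slope in \<open>A\<close> occurs. Put
  \<open>g = f - x\<^sup>*\<close>. A direction in which some sublevel set of \<open>g\<close> contains a half-line is nonpositive on
  \<open>A - x\<^sup>*\<close>; as the closed cone spanned by \<open>A - x\<^sup>*\<close> is a subspace, it annihilates \<open>A - x\<^sup>*\<close>, so \<open>g\<close> is
  constant along it. Hence all sublevel sets have the same recession cone, the subspace \<open>N\<close>
  annihilating \<open>A - x\<^sup>*\<close>. Weak local compactness makes \<open>N\<close> finite-dimensional, with a weakly closed
  complement \<open>M\<close>. A sublevel set intersected with \<open>M\<close> is closed, convex, weakly locally compact and
  contains no half-line, so it is weakly compact, and \<open>g\<close> attains its infimum there. The solution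
  set is a sublevel set \<open>S\<close> of \<open>g\<close>, and \<open>S = (S \<inter> M) + N\<close>.
\<close>

subsection \<open>The Hahn--Banach theorem\<close>

definition sublinear :: "('a::real_vector \<Rightarrow> real) \<Rightarrow> bool" where
  "sublinear p \<longleftrightarrow> (\<forall>x y. p (x + y) \<le> p x + p y) \<and> (\<forall>c x. 0 \<le> c \<longrightarrow> p (c *\<^sub>R x) = c * p x)"

lemma sublinear_add: "sublinear p \<Longrightarrow> p (x + y) \<le> p x + p y"
  and sublinear_scaleR: "sublinear p \<Longrightarrow> 0 \<le> c \<Longrightarrow> p (c *\<^sub>R x) = c * p x"
  by (auto simp: sublinear_def)

lemma sublinear_zero: "sublinear p \<Longrightarrow> p 0 = 0"
  using sublinear_scaleR[of p 0 0] by simp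

lemma sublinear_minus: "sublinear p \<Longrightarrow> - p (- x) \<le> p x"
  using sublinear_add[of p x "- x"] sublinear_zero[of p] by simp

text \<open>One inequality for positive scalars suffices: applied to \<open>inverse c\<close> and
  \<open>c *\<^sub>R x\<close>, it yields the reverse inequality.\<close>

lemma sublinearI:
  assumes add: "\<And>x y. p (x + y) \<le> p x + p y"
    and zero: "p 0 = 0"
    and scale: "\<And>c x. 0 < c \<Longrightarrow> p (c *\<^sub>R x) \<le> c * p x"
  shows "sublinear p"
proof -
  have "p (c *\<^sub>R x) = c * p x" if "0 \<le> c" for c x
  proof (cases "c = 0")
    case False
    with that have c: "c > 0" by simp
    have "p (inverse c *\<^sub>R (c *\<^sub>R x)) \<le> inverse c * p (c *\<^sub>R x)"
      using c by (intro scale) auto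
    then have "c * p x \<le> p (c *\<^sub>R x)"
      using c by (simp add: field_simps)
    with scale[OF c] show ?thesis by (simp add: antisym)
  qed (simp add: zero)
  with add show ?thesis by (auto simp: sublinear_def)
qed

text \<open>An infimal convolution: \<open>E\<close> lists the allowed shifts of the argument
  together with their costs. A half-line as \<open>E\<close> yields additivity of minimal
  functionals; the cone over an epigraph yields the sandwich theorem.\<close>

definition perturbed_inf :: "('a::real_vector \<Rightarrow> real) \<Rightarrow> ('a \<times> real) set \<Rightarrow> 'a \<Rightarrow> real" where
  "perturbed_inf p E v = (INF e\<in>E. p (v + fst e) + snd e)"

text \<open>The bound on \<open>E\<close> makes the infimum finite, since every term is at least
  \<open>- p (- v)\<close>. Subadditivity and homogeneity are inherited because a convex cone is
  closed under sums and nonnegative multiples.\<close>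

lemma
  assumes p: "sublinear p"
    and E: "convex E" "cone E" "E \<noteq> {}"
    and bound: "\<forall>(w, s)\<in>E. - p w \<le> s"
  shows sublinear_perturbed_inf: "sublinear (perturbed_inf p E)"
    and perturbed_inf_le: "\<And>v w s. (w, s) \<in> E \<Longrightarrow> perturbed_inf p E v \<le> p (v + w) + s"
proof -
  have add: "x + y \<in> E" if "x \<in> E" "y \<in> E" for x y
    using convex_cone[of E] E that by blast
  have scale: "c *\<^sub>R x \<in> E" if "x \<in> E" "c \<ge> 0" for x c
    using E that by (simp add: mem_cone)
  have zero: "(0, 0) \<in> E"
    using cone_contains_0[OF E(2)] E(3) by (simp add: zero_prod_def)
  have low: "- p (- v) \<le> p (v + fst e) + snd e" if "e \<in> E" for v e
  proof -
    have "p (fst e) \<le> p (v + fst e) + p (- v)"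
      using sublinear_add[OF p, of "v + fst e" "- v"] by simp
    moreover have "- p (fst e) \<le> snd e"
      using bound that by (auto simp: case_prod_beta)
    ultimately show ?thesis by simp
  qed
  then have bdd: "bdd_below ((\<lambda>e. p (v + fst e) + snd e) ` E)" for v
    by (intro bdd_belowI2)
  show le: "perturbed_inf p E v \<le> p (v + w) + s" if "(w, s) \<in> E" for v w s
    unfolding perturbed_inf_def using cINF_lower[OF bdd that, of v] by simp
  have ge: "c \<le> perturbed_inf p E v" if "\<And>w s. (w, s) \<in> E \<Longrightarrow> c \<le> p (v + w) + s" for c v
    unfolding perturbed_inf_def using that E(3) by (intro cINF_greatest) auto
  show "sublinear (perturbed_inf p E)"
  proof (rule sublinearI)
    fix x y
    have "perturbed_inf p E (x + y) - (p (x + w) + s) \<le> perturbed_inf p E y"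
      if ws: "(w, s) \<in> E" for w s
    proof (rule ge)
      fix w' s' assume ws': "(w', s') \<in> E"
      have "perturbed_inf p E (x + y) \<le> p ((x + y) + (w + w')) + (s + s')"
        using add[OF ws ws'] by (intro le) simp
      also have "p ((x + y) + (w + w')) \<le> p (x + w) + p (y + w')"
        using sublinear_add[OF p, of "x + w" "y + w'"] by (simp add: algebra_simps)
      finally show "perturbed_inf p E (x + y) - (p (x + w) + s) \<le> p (y + w') + s'" by simp
    qed
    then have "perturbed_inf p E (x + y) - perturbed_inf p E y \<le> perturbed_inf p E x"
      by (intro ge) (auto simp: algebra_simps)
    then show "perturbed_inf p E (x + y) \<le> perturbed_inf p E x + perturbed_inf p E y" by simp
  next
    show "perturbed_inf p E 0 = 0"
    proof (rule antisym)
      show "perturbed_inf p E 0 \<le> 0" using le[OF zero, of 0] sublinear_zero[OF p] by simp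
      show "0 \<le> perturbed_inf p E 0"
        using low[of _ 0] sublinear_zero[OF p] by (intro ge) force
    qed
  next
    fix c :: real and x assume c: "0 < c"
    have "perturbed_inf p E (c *\<^sub>R x) / c \<le> perturbed_inf p E x"
    proof (rule ge)
      fix w s assume ws: "(w, s) \<in> E"
      have "perturbed_inf p E (c *\<^sub>R x) \<le> p (c *\<^sub>R x + c *\<^sub>R w) + c * s"
        using scale[OF ws, of c] c by (intro le) simp
      also have "\<dots> = c * (p (x + w) + s)"
        using sublinear_scaleR[OF p, of c "x + w"] c by (simp add: algebra_simps)
      finally show "perturbed_inf p E (c *\<^sub>R x) / c \<le> p (x + w) + s"
        using c by (simp add: field_simps)
    qed
    then show "perturbed_inf p E (c *\<^sub>R x) \<le> c * perturbed_inf p E x"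
      using c by (simp add: field_simps)
  qed
qed

text \<open>Minimality is applied to the infimum of \<open>p (x + t *\<^sub>R y) - t * p y\<close> over \<open>t \<ge> 0\<close>.\<close>

lemma minimal_sublinear_linear:
  assumes p: "sublinear p"
    and min: "\<And>q. sublinear q \<Longrightarrow> q \<le> p \<Longrightarrow> q = p"
  shows "linear p"
proof -
  have add: "p (x + y) = p x + p y" for x y
  proof (rule antisym)
    show "p (x + y) \<le> p x + p y" by (rule sublinear_add[OF p])
    define E where "E = (\<lambda>t. t *\<^sub>R (y, - p y)) ` {0..}"
    have "convex E \<and> cone E"
      unfolding convex_cone E_def
      by (auto simp del: scaleR_Pair simp flip: scaleR_add_left intro!: imageI)
    then have E: "convex E" "cone E" "E \<noteq> {}" by (auto simp: E_def)
    have bound: "\<forall>(w, s)\<in>E. - p w \<le> s"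
      using sublinear_scaleR[OF p] by (auto simp: E_def)
    have "(0, 0) \<in> E" by (auto simp: E_def intro!: image_eqI[of _ _ 0])
    then have "perturbed_inf p E \<le> p"
      using perturbed_inf_le[OF p E bound] by (force simp: le_fun_def)
    then have "perturbed_inf p E = p"
      by (rule min[OF sublinear_perturbed_inf[OF p E bound]])
    moreover have "(y, - p y) \<in> E" by (auto simp: E_def intro!: image_eqI[of _ _ 1])
    ultimately show "p x + p y \<le> p (x + y)"
      using perturbed_inf_le[OF p E bound, of y "- p y" x] by simp
  qed
  have neg: "p (- x) = - p x" for x
    using add[of x "- x"] sublinear_zero[OF p] by simp
  show ?thesis
  proof (rule linearI[OF add])
    fix c x show "p (c *\<^sub>R x) = c *\<^sub>R p x"
    proof (cases "c \<ge> 0")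
      case False
      then have "p ((- c) *\<^sub>R x) = - c * p x" by (intro sublinear_scaleR[OF p]) simp
      then show ?thesis using neg[of "c *\<^sub>R x"] by simp
    qed (use sublinear_scaleR[OF p] in auto)
  qed
qed

text \<open>Zorn's lemma gives a minimal sublinear functional below \<open>p\<close>, and minimal
  ones are linear.\<close>

theorem Hahn_Banach_sublinear:
  assumes p: "sublinear p"
  obtains \<phi> where "linear \<phi>" "\<And>x. \<phi> x \<le> p x"
proof -
  define S where "S = {q. sublinear q \<and> q \<le> p}"
  \<comment> \<open>The order is reversed, so that maximal elements for Zorn's lemma are pointwise
    minimal functionals.\<close>
  define R where "R = (\<lambda>f g :: 'a \<Rightarrow> real. g \<le> f)"
  have "\<exists>m\<in>S. \<forall>q\<in>S. R m q \<longrightarrow> q = m"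
  proof (rule predicate_Zorn)
    show "partial_order_on S (relation_of R S)"
      by (rule partial_order_on_relation_ofI) (auto simp: R_def)
  next
    fix C assume C: "C \<in> Chains (relation_of R S)"
    have CS: "q \<in> S" if "q \<in> C" for q
      using C that by (auto simp: Chains_def relation_of_def)
    have total: "q \<le> r \<or> r \<le> q" if "q \<in> C" "r \<in> C" for q r
      using C that by (auto simp: Chains_def relation_of_def R_def)
    show "\<exists>u\<in>S. \<forall>q\<in>C. R q u"
    proof (cases "C = {}")
      case True
      then show ?thesis using p by (auto simp: S_def)
    next
      case False
      \<comment> \<open>The pointwise infimum of a chain is finite because all its members lie above
        \<open>- p (- x)\<close>.\<close>
      define u where "u x = (INF q\<in>C. q x)" for x
      have sub: "sublinear q" if "q \<in> C" for q using CS[OF that] by (simp add: S_def)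
      have "- p (- x) \<le> q x" if "q \<in> C" for q x
      proof -
        have "q (- x) \<le> p (- x)" using CS[OF that] by (simp add: S_def le_fun_def)
        then show ?thesis using sublinear_minus[OF sub[OF that], of x] by simp
      qed
      then have bdd: "bdd_below ((\<lambda>q. q x) ` C)" for x
        by (intro bdd_belowI2)
      have le: "u x \<le> q x" if "q \<in> C" for q x
        unfolding u_def using that by (rule cINF_lower[OF bdd])
      have ge: "c \<le> u x" if "\<And>q. q \<in> C \<Longrightarrow> c \<le> q x" for c x
        unfolding u_def using False that by (rule cINF_greatest)
      have "sublinear u"
      proof (rule sublinearI)
        fix x y
        have "u (x + y) - q x \<le> u y" if q: "q \<in> C" for q
        proof (rule ge)
          fix r assume r: "r \<in> C"
          \<comment> \<open>Infima of sublinear functionals need not be subadditive; in a chain, the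
            smaller of \<open>q\<close> and \<open>r\<close> bounds both terms at once.\<close>
          obtain t where t: "t \<in> C" "t \<le> q" "t \<le> r"
            using total[OF q r] q r by blast
          have "u (x + y) \<le> t (x + y)" by (rule le[OF t(1)])
          also have "\<dots> \<le> t x + t y" by (rule sublinear_add[OF sub[OF t(1)]])
          also have "\<dots> \<le> q x + r y" using t by (auto simp: le_fun_def intro: add_mono)
          finally show "u (x + y) - q x \<le> r y" by simp
        qed
        then have "u (x + y) - u y \<le> u x"
          by (intro ge) (simp add: algebra_simps)
        then show "u (x + y) \<le> u x + u y" by simp
      next
        have "(\<lambda>q. q 0) ` C = {0 :: real}"
          using False sublinear_zero[OF sub] by (auto simp: image_iff)
        then show "u 0 = 0" by (simp add: u_def)
      next
        fix c :: real and x assume c: "0 < c"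
        have "u (c *\<^sub>R x) / c \<le> u x"
        proof (rule ge)
          fix q assume q: "q \<in> C"
          show "u (c *\<^sub>R x) / c \<le> q x"
            using le[OF q, of "c *\<^sub>R x"] sublinear_scaleR[OF sub[OF q], of c x] c
            by (simp add: field_simps)
        qed
        then show "u (c *\<^sub>R x) \<le> c * u x"
          using c by (simp add: field_simps)
      qed
      moreover have "u \<le> p"
      proof -
        obtain q where q: "q \<in> C" using False by blast
        then have "u \<le> q" using le by (simp add: le_fun_def)
        also have "q \<le> p" using CS[OF q] by (simp add: S_def)
        finally show ?thesis .
      qed
      ultimately have "u \<in> S" by (simp add: S_def)
      moreover have "\<forall>q\<in>C. R q u" using le by (simp add: R_def le_fun_def)
      ultimately show ?thesis by blast
    qed
  qed
  then obtain m where m: "m \<in> S" and min: "\<And>q. q \<in> S \<Longrightarrow> q \<le> m \<Longrightarrow> q = m"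
    by (auto simp: R_def)
  have "linear m"
  proof (rule minimal_sublinear_linear)
    show "sublinear m" using m by (simp add: S_def)
    show "q = m" if "sublinear q" "q \<le> m" for q
      using m that by (intro min) (auto simp: S_def)
  qed
  moreover have "m x \<le> p x" for x using m by (simp add: S_def le_fun_def)
  ultimately show ?thesis by (rule that)
qed

text \<open>
  Applied to the epigraph of a convex function \<open>h\<close> with \<open>- p \<le> h\<close>, this is the sandwich theorem:
  the linear functional \<open>- \<phi>\<close> lies below \<open>h\<close>.
\<close>

lemma sandwich_linear:
  assumes p: "sublinear p" and E: "convex E" "E \<noteq> {}"
    and bound: "\<And>w s. (w, s) \<in> E \<Longrightarrow> - p w \<le> s"
  obtains \<phi> where "linear \<phi>" "\<And>x. \<phi> x \<le> p x" "\<And>w s. (w, s) \<in> E \<Longrightarrow> - \<phi> w \<le> s"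
proof -
  \<comment> \<open>\<open>perturbed_inf\<close> needs a cone; by homogeneity of \<open>p\<close>
    the bound survives passing to the cone hull.\<close>
  let ?E = "cone hull E"
  have hE: "convex ?E" "cone ?E" "?E \<noteq> {}"
    using convex_cone_hull[OF E(1)] cone_cone_hull[of E] E(2) cone_hull_empty_iff[of E] by auto
  have hbound: "\<forall>(w, s)\<in>?E. - p w \<le> s"
  proof clarify
    fix w s assume ws: "(w, s) \<in> ?E"
    obtain c w' s' where c: "c \<ge> 0" "(w', s') \<in> E" "w = c *\<^sub>R w'" "s = c * s'"
      using ws by (auto simp: cone_hull_expl)
    show "- p w \<le> s"
      using mult_left_mono[OF bound[OF c(2)] c(1)] sublinear_scaleR[OF p c(1), of w'] c by simp
  qed
  note le = perturbed_inf_le[OF p hE hbound]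
  obtain \<phi> where \<phi>: "linear \<phi>" "\<And>x. \<phi> x \<le> perturbed_inf p ?E x"
    using Hahn_Banach_sublinear[OF sublinear_perturbed_inf[OF p hE hbound]] by blast
  show ?thesis
  proof (rule that[OF \<phi>(1)])
    fix x
    have "(0, 0) \<in> ?E" using E(2) cone_hull_contains_0[of E] by (simp add: zero_prod_def)
    from le[OF this, of x] \<phi>(2)[of x] show "\<phi> x \<le> p x" by simp
  next
    fix w s assume "(w, s) \<in> E"
    then have "(w, s) \<in> ?E" by (rule hull_inc)
    \<comment> \<open>At the argument \<open>- w\<close> the shift by \<open>w\<close> leaves
      \<open>p 0 + s\<close>, which is \<open>s\<close>.\<close>
    from le[OF this, of "- w"] \<phi>(2)[of "- w"] show "- \<phi> w \<le> s"
      using sublinear_zero[OF p] linear_neg[OF \<phi>(1), of w] by simp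
  qed
qed

subsection \<open>Affine minorants in locally convex spaces\<close>

lemma tendsto_scaleR_lch:
  fixes f :: "'b \<Rightarrow> real" and g :: "'b \<Rightarrow> 'a::locally_convex_hausdorff"
  assumes "(f \<longlongrightarrow> c) F" "(g \<longlongrightarrow> x) F"
  shows "((\<lambda>y. f y *\<^sub>R g y) \<longlongrightarrow> c *\<^sub>R x) F"
  using filterlim_compose[OF tendsto_scaleR_nhds filterlim_Pair[OF assms]] by simp

lemma eventually_nhds_zero_scaleR:
  fixes P :: "'a::locally_convex_hausdorff \<Rightarrow> bool"
  assumes "eventually P (nhds 0)"
  shows "eventually (\<lambda>x. P (c *\<^sub>R x)) (nhds 0)"
proof -
  have "((\<lambda>x::'a. c *\<^sub>R x) \<longlongrightarrow> c *\<^sub>R 0) (nhds 0)"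
    by (intro tendsto_scaleR_lch tendsto_const filterlim_ident)
  then show ?thesis using assms by (auto simp: filterlim_iff)
qed

lemma eventually_nhds_zero_translate:
  fixes P :: "'a::locally_convex_hausdorff \<Rightarrow> bool"
  assumes "eventually P (nhds x)"
  shows "eventually (\<lambda>v. P (x + v)) (nhds 0)"
proof -
  have "((\<lambda>v. x + v) \<longlongrightarrow> x + 0) (nhds 0)"
    by (intro tendsto_add tendsto_const filterlim_ident)
  then show ?thesis using assms by (auto simp: filterlim_iff)
qed

lemma nhds_zero_absorbing:
  fixes P :: "'a::locally_convex_hausdorff \<Rightarrow> bool"
  assumes "eventually P (nhds 0)"
  obtains t where "t > 0" "P (inverse t *\<^sub>R x)"
proof -
  have "((\<lambda>t. t *\<^sub>R x) \<longlongrightarrow> 0 *\<^sub>R x) (at_right (0::real))"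
    by (intro tendsto_scaleR_lch tendsto_const tendsto_ident_at)
  then have "eventually (\<lambda>t. P (t *\<^sub>R x)) (at_right (0::real))"
    using assms by (auto simp: filterlim_iff)
  then have "eventually (\<lambda>t. P (t *\<^sub>R x) \<and> t > 0) (at_right (0::real))"
    using eventually_at_right_less[of 0] by (rule eventually_conj)
  then obtain t where "P (t *\<^sub>R x)" "t > 0"
    using eventually_happens trivial_limit_at_right_real by blast
  then show ?thesis using that[of "inverse t"] by simp
qed

text \<open>The Minkowski functional of a convex neighbourhood \<open>V\<close> inside
  \<open>P\<close>. As \<open>V\<close> need not be symmetric, it is only sublinear, not a
  seminorm.\<close>

lemma ex_gauge:
  fixes P :: "'a::locally_convex_hausdorff \<Rightarrow> bool"
  assumes P: "eventually P (nhds 0)"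
  obtains p where "sublinear p" "\<And>x. 0 \<le> p x" "\<And>x. p x < 1 \<Longrightarrow> P x"
    "eventually (\<lambda>x. p x \<le> 1) (nhds 0)"
proof -
  obtain V where cV: "\<forall>x\<in>V. \<forall>y\<in>V. \<forall>u\<ge>0. \<forall>v\<ge>0. u + v = 1 \<longrightarrow> u *\<^sub>R x + v *\<^sub>R y \<in> V"
    and nV: "eventually (\<lambda>x. x \<in> V) (nhds 0)" and VP: "V \<subseteq> Collect P"
    using convex_nhds_zero[of "Collect P"] P by auto
  have "0 \<in> V" using nV by (rule eventually_nhds_x_imp_x)
  define T where "T x = {t. t > 0 \<and> inverse t *\<^sub>R x \<in> V}" for x
  define p where "p x = Inf (T x)" for x
  have ne: "T x \<noteq> {}" for x
    using nhds_zero_absorbing[OF nV, of x] by (auto simp: T_def)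
  have bdd: "bdd_below (T x)" for x
    by (intro bdd_belowI[of _ 0]) (auto simp: T_def)
  have le: "p x \<le> t" if "t \<in> T x" for x t
    unfolding p_def using that bdd by (rule cInf_lower)
  have ge: "c \<le> p x" if "\<And>t. t \<in> T x \<Longrightarrow> c \<le> t" for x c
    unfolding p_def using ne that by (rule cInf_greatest)
  have nonneg: "0 \<le> p x" for x by (rule ge) (simp add: T_def)
  have add_T: "s + t \<in> T (x + y)" if s: "s \<in> T x" and t: "t \<in> T y" for s t x y
  proof -
    have pos: "s > 0" "t > 0" using s t by (auto simp: T_def)
    \<comment> \<open>These weights sum to 1 and cancel the inner scalings, so the combination is a
      multiple of \<open>x + y\<close>.\<close>
    have "(s / (s + t)) *\<^sub>R (inverse s *\<^sub>R x) + (t / (s + t)) *\<^sub>R (inverse t *\<^sub>R y) \<in> V"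
      using s t pos by (intro cV[rule_format]) (auto simp: T_def add_divide_distrib[symmetric])
    moreover have "(s / (s + t)) *\<^sub>R (inverse s *\<^sub>R x) + (t / (s + t)) *\<^sub>R (inverse t *\<^sub>R y)
        = inverse (s + t) *\<^sub>R (x + y)"
      using pos by (simp add: scaleR_add_right inverse_eq_divide)
    ultimately show ?thesis using pos by (simp add: T_def)
  qed
  show ?thesis
  proof (rule that)
    show "sublinear p"
    proof (rule sublinearI)
      fix x y
      have "p (x + y) - s \<le> p y" if "s \<in> T x" for s
      proof (rule ge)
        fix t assume "t \<in> T y"
        from le[OF add_T[OF that this]] show "p (x + y) - s \<le> t" by simp
      qed
      then have "p (x + y) - p y \<le> p x" by (intro ge) (simp add: algebra_simps)
      then show "p (x + y) \<le> p x + p y" by simp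
    next
      have "p 0 \<le> 0 + e" if "e > 0" for e
        using \<open>0 \<in> V\<close> that le[of e 0] by (simp add: T_def)
      then show "p 0 = 0" using nonneg[of 0] by (meson antisym field_le_epsilon)
    next
      fix c :: real and x assume c: "0 < c"
      have "p (c *\<^sub>R x) / c \<le> p x"
      proof (rule ge)
        fix t assume "t \<in> T x"
        then have "c * t \<in> T (c *\<^sub>R x)" using c by (simp add: T_def inverse_eq_divide)
        from le[OF this] show "p (c *\<^sub>R x) / c \<le> t" using c by (simp add: field_simps)
      qed
      then show "p (c *\<^sub>R x) \<le> c * p x" using c by (simp add: field_simps)
    qed
    show "0 \<le> p x" for x by (rule nonneg)
    show "P x" if "p x < 1" for x
    proof -
      obtain t where t: "t \<in> T x" "t < 1"
        using cInf_lessD[OF ne, of x 1] \<open>p x < 1\<close> unfolding p_def by blast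
      then have "t *\<^sub>R (inverse t *\<^sub>R x) + (1 - t) *\<^sub>R 0 \<in> V"
        using cV \<open>0 \<in> V\<close> by (auto simp: T_def simp del: scaleR_scaleR scaleR_zero_right)
      then have "x \<in> V" using t by (simp add: T_def)
      then show ?thesis using VP by blast
    qed
    show "eventually (\<lambda>x. p x \<le> 1) (nhds 0)"
      using nV by eventually_elim (auto intro: le simp: T_def)
  qed
qed

text \<open>By linearity, an upper bound at both \<open>v\<close> and \<open>- v\<close> bounds the
  absolute value, and rescaling the neighbourhood makes that bound arbitrarily small.\<close>

lemma linear_continuous_of_bounded_above:
  fixes \<phi> :: "'a::locally_convex_hausdorff \<Rightarrow> real"
  assumes \<phi>: "linear \<phi>" and b: "eventually (\<lambda>v. \<phi> v \<le> b) (nhds 0)"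
  shows "continuous_on UNIV \<phi>"
proof -
  have "(\<phi> \<longlongrightarrow> \<phi> x) (nhds x)" for x
  proof (rule tendstoI)
    fix e :: real assume e: "e > 0"
    \<comment> \<open>The summand 1 keeps \<open>K\<close> positive even for \<open>b = 0\<close>
      and makes \<open>b < K * e\<close> strict.\<close>
    define K where "K = (\<bar>b\<bar> + 1) / e"
    have K: "K > 0" using e by (auto simp: K_def)
    have bK: "b < K * e" using e by (simp add: K_def)
    have "eventually (\<lambda>v. \<phi> (K *\<^sub>R v) \<le> b \<and> \<phi> ((- K) *\<^sub>R v) \<le> b) (nhds 0)"
      by (intro eventually_conj eventually_nhds_zero_scaleR[OF b])
    moreover have "((\<lambda>y. y - x) \<longlongrightarrow> x - x) (nhds x)"
      by (intro tendsto_diff tendsto_const filterlim_ident)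
    ultimately have "eventually (\<lambda>y. \<phi> (K *\<^sub>R (y - x)) \<le> b \<and> \<phi> ((- K) *\<^sub>R (y - x)) \<le> b) (nhds x)"
      by (auto simp: filterlim_iff)
    then show "eventually (\<lambda>y. dist (\<phi> y) (\<phi> x) < e) (nhds x)"
    proof eventually_elim
      case (elim y)
      then have "K * \<bar>\<phi> y - \<phi> x\<bar> \<le> b"
        by (simp add: linear_cmul[OF \<phi>] linear_diff[OF \<phi>] linear_neg[OF \<phi>] abs_if algebra_simps)
      with bK have "K * \<bar>\<phi> y - \<phi> x\<bar> < K * e" by simp
      with K show ?case by (simp add: dist_real_def)
    qed
  qed
  then show ?thesis
    by (simp add: continuous_on_eq_continuous_at isCont_def tendsto_at_iff_tendsto_nhds)
qed

lemma linear_pairing: "linear (pairing \<phi>)"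
  and continuous_pairing: "continuous_on UNIV (pairing \<phi>)"
  using pairing[of \<phi>] by auto

lemmas pairing_simps =
  linear_add[OF linear_pairing] linear_diff[OF linear_pairing] linear_cmul[OF linear_pairing]
  linear_0[OF linear_pairing] linear_sum[OF linear_pairing] linear_neg[OF linear_pairing]
  plus_dual.rep_eq minus_dual.rep_eq uminus_dual.rep_eq scaleR_dual.rep_eq zero_dual.rep_eq

text \<open>The pointwise form of Fenchel--Moreau, valid also where \<open>h x\<close> is infinite.
  With \<open>(x, c)\<close> moved to the origin, the epigraph lies above \<open>- q\<close> for a
  multiple \<open>q\<close> of a continuous gauge; the sandwich theorem inserts a linear functional,
  whose bound by \<open>q\<close> makes it continuous.\<close>

lemma Gamma_class_affine_minorant:
  assumes h: "h \<in> Gamma_class" and c: "ereal c < h x"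
  obtains \<phi> \<beta> where "\<And>y. ereal (pairing \<phi> y - \<beta>) \<le> h y" "pairing \<phi> x - \<beta> = c"
proof -
  have lsc: "lower_semicontinuous h" and cvx: "convex {(y, r). h y \<le> ereal r}"
    and ninf: "\<And>y. h y \<noteq> - \<infinity>"
    using h by (auto simp: Gamma_class_def convex_fun_def proper_fun_def)
  obtain x0 where "h x0 < \<infinity>"
    using h by (auto simp: Gamma_class_def proper_fun_def effective_domain_def)
  with ninf[of x0] obtain h0 where h0: "h x0 = ereal h0" by (cases "h x0") auto
  have "eventually (\<lambda>v. ereal c < h (x + v)) (nhds 0)"
    using lsc c by (intro eventually_nhds_zero_translate) (simp add: lower_semicontinuous_def)
  moreover have "eventually (\<lambda>v. ereal (h0 - 1) < h (x0 + v)) (nhds 0)"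
    using lsc h0 by (intro eventually_nhds_zero_translate) (simp add: lower_semicontinuous_def)
  ultimately obtain p where p: "sublinear p" "\<And>v. 0 \<le> p v"
    and px: "\<And>v. p v < 1 \<Longrightarrow> ereal c < h (x + v)"
    and px0: "\<And>v. p v < 1 \<Longrightarrow> ereal (h0 - 1) < h (x0 + v)"
    and pn: "eventually (\<lambda>v. p v \<le> 1) (nhds 0)"
    using ex_gauge[OF eventually_conj] by metis
  \<comment> \<open>A point far from \<open>x0\<close> with too small a value would, by convexity along the segment to \<open>x0\<close>,
     contradict the lower bound near \<open>x0\<close>; so \<open>h\<close> decreases at most linearly in the gauge.\<close>
  have low: "h0 - 1 - 2 * p (z - x0) \<le> r" if zr: "h z \<le> ereal r" for z r
  proof (cases "p (z - x0) < 1")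
    case True
    have "ereal (h0 - 1) < h z" using px0[OF True] by simp
    from less_le_trans[OF this zr] show ?thesis using p(2)[of "z - x0"] by simp
  next
    case False
    \<comment> \<open>The factor 2 moves the point on the segment to gauge 1/2, strictly within the
      range of \<open>px0\<close>.\<close>
    define s where "s = 2 * p (z - x0)"
    have s: "s \<ge> 2" using False by (simp add: s_def)
    have "p (inverse s *\<^sub>R (z - x0)) < 1"
      using sublinear_scaleR[OF p(1), of "inverse s" "z - x0"] s False by (simp add: s_def)
    then have lt: "ereal (h0 - 1) < h (x0 + inverse s *\<^sub>R (z - x0))" by (rule px0)
    have "(1 - inverse s) *\<^sub>R (x0, h0) + inverse s *\<^sub>R (z, r) \<in> {(y, r). h y \<le> ereal r}"
      using cvx h0 zr s by (intro convexD) (auto simp: field_simps)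
    moreover have "(1 - inverse s) *\<^sub>R x0 + inverse s *\<^sub>R z = x0 + inverse s *\<^sub>R (z - x0)"
      by (simp add: algebra_simps)
    ultimately have "h (x0 + inverse s *\<^sub>R (z - x0)) \<le> ereal ((1 - inverse s) * h0 + inverse s * r)"
      by simp
    with lt have "ereal (h0 - 1) < ereal ((1 - inverse s) * h0 + inverse s * r)"
      by (rule less_le_trans)
    then have "s * (h0 - 1) < s * ((1 - inverse s) * h0 + inverse s * r)"
      using s by simp
    also have "\<dots> = s * h0 - h0 + r" using s by (simp add: algebra_simps)
    finally show ?thesis by (simp add: algebra_simps s_def)
  qed
  \<comment> \<open>Recentred at \<open>x\<close>, the bound \<open>low\<close> reads
    \<open>\<alpha> - 2 * p w\<close>. In \<open>n\<close>, the 2 absorbs this slope, and the rest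
    makes up for \<open>c - \<alpha>\<close> where \<open>p w \<ge> 1\<close>; where
    \<open>p w < 1\<close>, lower semicontinuity at \<open>x\<close> already suffices.\<close>
  define \<alpha> where "\<alpha> = h0 - 1 - 2 * p (x - x0)"
  define n where "n = 2 + max 0 (c - \<alpha>)"
  define q where "q v = n * p v" for v
  define E where "E = (+) (- x, - c) ` {(y, r). h y \<le> ereal r}"
  have q: "sublinear q"
  proof (rule sublinearI)
    show "q (y + z) \<le> q y + q z" for y z
      using mult_left_mono[OF sublinear_add[OF p(1), of y z], of n]
      by (simp add: q_def n_def distrib_left)
  qed (auto simp: q_def sublinear_zero[OF p(1)] sublinear_scaleR[OF p(1)])
  have "convex E" unfolding E_def by (rule convex_translation[OF cvx])
  moreover have "E \<noteq> {}" using h0 by (auto simp: E_def intro!: exI[of _ x0] exI[of _ h0])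
  moreover have "- q w \<le> s" if "(w, s) \<in> E" for w s
  proof -
    obtain z r where zr: "h z \<le> ereal r" "w = z - x" "s = r - c"
      using \<open>(w, s) \<in> E\<close> by (auto simp: E_def)
    have n: "n \<ge> 2" by (simp add: n_def)
    show ?thesis
    proof (cases "p w < 1")
      case True
      have "ereal c < h z" using px[OF True] zr by simp
      from less_le_trans[OF this zr(1)] have "c < r" by simp
      moreover have "0 \<le> n * p w" using p(2)[of w] n by simp
      ultimately show ?thesis using zr by (simp add: q_def)
    next
      case False
      have "p (z - x0) \<le> p w + p (x - x0)"
        using sublinear_add[OF p(1), of w "x - x0"] zr by simp
      with low[OF zr(1)] have "\<alpha> - 2 * p w \<le> r" by (simp add: \<alpha>_def)
      moreover have "c - \<alpha> \<le> (n - 2) * p w"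
      proof -
        have "c - \<alpha> \<le> (n - 2) * 1" by (simp add: n_def)
        also have "\<dots> \<le> (n - 2) * p w" using n False by (intro mult_left_mono) auto
        finally show ?thesis .
      qed
      ultimately show ?thesis using zr(3) by (simp add: q_def algebra_simps)
    qed
  qed
  ultimately obtain \<psi> where \<psi>: "linear \<psi>" "\<And>v. \<psi> v \<le> q v" "\<And>w s. (w, s) \<in> E \<Longrightarrow> - \<psi> w \<le> s"
    using sandwich_linear[OF q] by blast
  have "eventually (\<lambda>v. \<psi> v \<le> n) (nhds 0)"
    using pn
  proof eventually_elim
    case (elim v)
    have "\<psi> v \<le> n * p v" using \<psi>(2)[of v] by (simp add: q_def)
    also have "\<dots> \<le> n * 1" using elim by (intro mult_left_mono) (auto simp: n_def)
    finally show ?case by simp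
  qed
  then have "continuous_on UNIV \<psi>" by (rule linear_continuous_of_bounded_above[OF \<psi>(1)])
  with \<psi>(1) obtain \<eta> where "pairing \<eta> = \<psi>"
    using Abs_dual_inverse[of \<psi>] by auto
  then have \<phi>: "pairing (- \<eta>) y = - \<psi> y" for y
    by (simp add: uminus_dual.rep_eq)
  show ?thesis
  proof (rule that[of "- \<eta>" "- \<psi> x - c"])
    show "ereal (pairing (- \<eta>) y - (- \<psi> x - c)) \<le> h y" for y
    proof (rule ereal_le_real)
      fix r assume "h y \<le> ereal r"
      then have "(y - x, r - c) \<in> E" by (force simp: E_def image_iff)
      from \<psi>(3)[OF this] show "ereal (pairing (- \<eta>) y - (- \<psi> x - c)) \<le> ereal r"
        by (simp add: \<phi> linear_diff[OF \<psi>(1)])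
    qed
  qed (simp add: \<phi>)
qed

text \<open>The indicator function of \<open>{0}\<close> is lower semicontinuous because the space
  is Hausdorff; an affine minorant of it that equals 1 at a nonzero \<open>x\<close> has a slope
  that does not vanish there.\<close>

lemma dual_separates_zero:
  fixes x :: "'a::locally_convex_hausdorff"
  assumes "\<And>\<phi>. pairing \<phi> x = 0"
  shows "x = 0"
proof (rule ccontr)
  assume x: "x \<noteq> 0"
  define h where "h y = (if y = 0 then 0 else \<infinity> :: ereal)" for y :: 'a
  have "{(y, r). h y \<le> ereal r} = {0} \<times> {0..}" by (auto simp: h_def split: if_splits)
  then have "convex_fun h" by (simp add: convex_fun_def convex_Times)
  moreover have "lower_semicontinuous h"
    unfolding lower_semicontinuous_def
  proof (intro allI impI)
    fix y a assume a: "a < h y"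
    show "eventually (\<lambda>z. a < h z) (nhds y)"
    proof (cases "y = 0")
      case True
      with a have "a < h z" for z by (auto simp: h_def)
      then show ?thesis by simp
    next
      case False
      then have "eventually (\<lambda>z. z \<in> - {0}) (nhds y)"
        by (intro eventually_nhds_in_open) auto
      then show ?thesis by eventually_elim (use a False in \<open>auto simp: h_def\<close>)
    qed
  qed
  ultimately have "h \<in> Gamma_class"
    by (auto simp: Gamma_class_def proper_fun_def effective_domain_def h_def intro: exI[of _ 0])
  moreover have "ereal 1 < h x" using x by (simp add: h_def)
  ultimately obtain \<phi> \<beta> where \<phi>: "\<And>y. ereal (pairing \<phi> y - \<beta>) \<le> h y" "pairing \<phi> x - \<beta> = 1"
    using Gamma_class_affine_minorant by blast
  from \<phi>(1)[of 0] \<phi>(2) assms[of \<phi>] show False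
    by (simp add: h_def pairing_simps)
qed

subsection \<open>The weak topology\<close>

lemma topspace_weak_topology [simp]: "topspace weak_topology = UNIV"
proof -
  have "UNIV \<in> {pairing \<phi> -` U | \<phi> U. open U}" using open_UNIV by force
  then show ?thesis unfolding weak_topology_def topology_generated_by_topspace by blast
qed

lemma topspace_weak_star_topology [simp]: "topspace weak_star_topology = UNIV"
proof -
  have "UNIV \<in> {(\<lambda>\<phi>. pairing \<phi> x) -` U | x U. open U}" using open_UNIV by force
  then show ?thesis unfolding weak_star_topology_def topology_generated_by_topspace by blast
qed

lemma continuous_map_pairing [continuous_intros]:
  "continuous_map weak_topology euclideanreal (pairing \<phi>)"
proof -
  have "openin weak_topology (pairing \<phi> -` U)" if "open U" for U
    unfolding weak_topology_def using that by (intro topology_generated_by_Basis) blast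
  then show ?thesis by (simp add: continuous_map_def vimage_def)
qed

lemma continuous_map_evaluation [continuous_intros]:
  "continuous_map weak_star_topology euclideanreal (\<lambda>\<phi>. pairing \<phi> x)"
proof -
  have "openin weak_star_topology ((\<lambda>\<phi>. pairing \<phi> x) -` U)" if "open U" for U
    unfolding weak_star_topology_def using that by (intro topology_generated_by_Basis) blast
  then show ?thesis by (simp add: continuous_map_def vimage_def)
qed

lemma continuous_map_weak_affine:
  fixes a :: "'a::locally_convex_hausdorff"
  shows "continuous_map weak_topology weak_topology (\<lambda>y. a + c *\<^sub>R y)"
proof -
  have pre: "openin weak_topology {y. pairing \<phi> (a + c *\<^sub>R y) \<in> U}" if "open U" for \<phi> U
  proof -
    have "continuous_map weak_topology euclideanreal (\<lambda>y. pairing \<phi> a + c * pairing \<phi> y)"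
      by (intro continuous_intros)
    from openin_continuous_map_preimage[OF this, of U] that show ?thesis
      by (simp add: pairing_simps)
  qed
  have "continuous_map weak_topology (topology_generated_by {pairing \<phi> -` U | \<phi> U. open U})
      (\<lambda>y. a + c *\<^sub>R y)"
  proof (rule continuous_on_generated_topo)
    show "(\<lambda>y. a + c *\<^sub>R y) ` topspace weak_topology \<subseteq> \<Union>{pairing \<phi> -` U | \<phi> U. open U}"
      using topspace_weak_topology[where 'a = 'a]
      unfolding weak_topology_def topology_generated_by_topspace by simp
  qed (use pre in \<open>auto simp: vimage_def\<close>)
  then show ?thesis by (simp flip: weak_topology_def)
qed

text \<open>Induction on the generation of open sets: a finite intersection merges the two sets of
  functionals and takes the smaller radius.\<close>

lemma weak_neighbourhood_base:
  assumes "openin weak_topology U" "x \<in> U"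
  obtains F e where "finite F" "e > 0" "{y. \<forall>\<phi>\<in>F. \<bar>pairing \<phi> (y - x)\<bar> < e} \<subseteq> U"
proof -
  have "generate_topology_on {pairing \<phi> -` U | \<phi> U. open U} U"
    using assms(1) by (simp add: weak_topology_def openin_topology_generated_by_iff)
  then have "x \<in> U \<Longrightarrow> \<exists>F e. finite F \<and> e > 0 \<and> {y. \<forall>\<phi>\<in>F. \<bar>pairing \<phi> (y - x)\<bar> < e} \<subseteq> U"
  proof induction
    case (Int U V)
    then obtain F e G d where "finite F" "finite G" "e > 0" "d > 0"
      "{y. \<forall>\<phi>\<in>F. \<bar>pairing \<phi> (y - x)\<bar> < e} \<subseteq> U" "{y. \<forall>\<phi>\<in>G. \<bar>pairing \<phi> (y - x)\<bar> < d} \<subseteq> V"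
      by auto
    then show ?case by (intro exI[of _ "F \<union> G"] exI[of _ "min d e"]) auto
  next
    case (UN K)
    then obtain k where k: "k \<in> K" "x \<in> k" by blast
    from UN.IH[OF this] obtain F e where
      "finite F" "e > 0" "{y. \<forall>\<phi>\<in>F. \<bar>pairing \<phi> (y - x)\<bar> < e} \<subseteq> k" by blast
    with k show ?case by (intro exI[of _ F] exI[of _ e]) auto
  next
    case (Basis s)
    then obtain \<phi> W where W: "s = pairing \<phi> -` W" "open W" "pairing \<phi> x \<in> W" by auto
    then obtain e where "e > 0" "ball (pairing \<phi> x) e \<subseteq> W"
      using open_contains_ball by blast
    with W show ?case
      by (intro exI[of _ "{\<phi>}"] exI[of _ e])
        (auto simp: dist_real_def pairing_simps abs_minus_commute)
  qed simp
  with assms(2) that show ?thesis by blast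
qed

lemma closedin_weak_halfspace: "closedin weak_topology {y. pairing \<phi> y \<le> b}"
  using closedin_continuous_map_preimage[OF continuous_map_pairing, of "{..b}" \<phi>] by simp

lemma closedin_weak_kernel: "closedin weak_topology {y. \<forall>\<phi>\<in>G. pairing \<phi> y = 0}"
proof -
  \<comment> \<open>\<open>UNIV\<close> keeps the intersected family nonempty when \<open>G\<close>
    is empty.\<close>
  have "closedin weak_topology (\<Inter> (insert UNIV ((\<lambda>\<phi>. {y. pairing \<phi> y = 0}) ` G)))"
  proof (rule closedin_Inter)
    fix S assume "S \<in> insert UNIV ((\<lambda>\<phi>. {y. pairing \<phi> y = 0}) ` G)"
    then show "closedin weak_topology S"
      using closedin_topspace[of weak_topology]
        closedin_continuous_map_preimage[OF continuous_map_pairing, of "{0}"] by auto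
  qed simp
  moreover have "\<Inter> (insert UNIV ((\<lambda>\<phi>. {y. pairing \<phi> y = 0}) ` G)) = {y. \<forall>\<phi>\<in>G. pairing \<phi> y = 0}"
    by auto
  ultimately show ?thesis by simp
qed

section \<open>Compactness in the weak topology\<close>

lemma bounded_pairing_of_weakly_compact:
  assumes "compactin weak_topology K"
  obtains B where "\<And>y. y \<in> K \<Longrightarrow> \<bar>pairing \<phi> y\<bar> \<le> B"
proof -
  have "compact (pairing \<phi> ` K)"
    using image_compactin[OF assms continuous_map_pairing] by simp
  then have "bounded (pairing \<phi> ` K)" by (rule compact_imp_bounded)
  then show ?thesis using that by (auto simp: bounded_iff)
qed

text \<open>Compactness near the single point \<open>x\<close> spreads to all of \<open>C\<close>:
  every ray from \<open>x\<close> through a compact cross-section leaves \<open>C\<close>, and by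
  compactness it does so within a uniform factor.\<close>

lemma weakly_compact_of_no_rays:
  fixes C :: "'a::locally_convex_hausdorff set"
  assumes C: "convex C" "closedin weak_topology C" "x \<in> C"
    and loc: "openin weak_topology U" "x \<in> U" "compactin weak_topology K" "C \<inter> U \<subseteq> K"
    and no_rays: "\<And>d. (\<And>t. 0 \<le> t \<Longrightarrow> x + t *\<^sub>R d \<in> C) \<Longrightarrow> d = 0"
  shows "compactin weak_topology C"
proof -
  obtain F e where F: "finite F" "e > 0" "{y. \<forall>\<phi>\<in>F. \<bar>pairing \<phi> (y - x)\<bar> < e} \<subseteq> U"
    using weak_neighbourhood_base[OF loc(1,2)] by blast
  \<comment> \<open>A weakly continuous seminorm; its closed ball of radius \<open>e / 2\<close>
    around \<open>x\<close> fits into \<open>U\<close>, where only strict inequalities with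
    \<open>e\<close> are available.\<close>
  define p where "p d = (\<Sum>\<phi>\<in>F. \<bar>pairing \<phi> d\<bar>)" for d
  have p_scale: "p (t *\<^sub>R d) = t * p d" if "t \<ge> 0" for t d
    using that by (simp add: p_def pairing_simps abs_mult sum_distrib_left)
  have p_cont: "continuous_map weak_topology euclideanreal (\<lambda>y. p (y - x))"
    unfolding p_def pairing_simps by (intro continuous_intros F(1))
  define \<delta> where "\<delta> = e / 2"
  have \<delta>: "\<delta> > 0" using F(2) by (simp add: \<delta>_def)
  define Q where "Q = C \<inter> {y. p (y - x) \<le> \<delta>}"
  have "Q \<subseteq> U"
  proof
    fix y assume y: "y \<in> Q"
    have "\<bar>pairing \<phi> (y - x)\<bar> \<le> p (y - x)" if "\<phi> \<in> F" for \<phi>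
      unfolding p_def using that F(1) by (intro member_le_sum) auto
    then have "\<forall>\<phi>\<in>F. \<bar>pairing \<phi> (y - x)\<bar> < e"
      using y F(2) by (force simp: Q_def \<delta>_def)
    then show "y \<in> U" using F(3) by blast
  qed
  then have "Q \<subseteq> K" using loc(4) by (auto simp: Q_def)
  moreover have "closedin weak_topology Q"
    using closedin_continuous_map_preimage[OF p_cont, of "{..\<delta>}"] C(2)
    by (auto simp: Q_def intro!: closedin_Int)
  ultimately have Q: "compactin weak_topology Q"
    using closed_compactin[OF loc(3)] by blast
  \<comment> \<open>On the compact cross-section \<open>B\<close>, one factor \<open>T\<close> pushes every point out of \<open>C\<close>; by convexity
     \<open>C\<close> then lies in the dilation of \<open>Q\<close> by \<open>T\<close>.\<close>
  define B where "B = Q \<inter> {y. p (y - x) = \<delta>}"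
  have B: "compactin weak_topology B"
    using closedin_continuous_map_preimage[OF p_cont, of "{\<delta>}"] Q
    by (auto simp: B_def intro!: compact_Int_closedin)
  define ray where "ray t y = x + t *\<^sub>R (y - x)" for t :: real and y
  have ray_cont: "continuous_map weak_topology weak_topology (ray t)" for t
    using continuous_map_weak_affine[of "x - t *\<^sub>R x" t] by (simp add: ray_def[abs_def] algebra_simps)
  have ray_mono: "ray s y \<in> C" if "ray t y \<in> C" "0 \<le> s" "s \<le> t" "0 < t" for s t y
  proof -
    have "(1 - s / t) *\<^sub>R x + (s / t) *\<^sub>R ray t y \<in> C"
      using that C by (intro convexD) auto
    moreover have "(1 - s / t) *\<^sub>R x + (s / t) *\<^sub>R ray t y = ray s y"
      using that by (simp add: ray_def algebra_simps)
    ultimately show ?thesis by simp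
  qed
  define out where "out t = {y. ray t y \<notin> C}" for t
  have out_open: "openin weak_topology (out t)" for t
    using openin_continuous_map_preimage[OF ray_cont, of "- C" t] C(2)
    by (simp add: out_def closedin_def Compl_eq_Diff_UNIV)
  have "B \<subseteq> \<Union> (out ` {1..})"
  proof
    fix y assume y: "y \<in> B"
    have "\<exists>t\<ge>1. ray t y \<notin> C"
    proof (rule ccontr)
      assume "\<not> ?thesis"
      then have far: "ray t y \<in> C" if "t \<ge> 1" for t using that by blast
      have "ray t y \<in> C" if "0 \<le> t" for t
        using ray_mono[OF far[of "max t 1"], of t] that by auto
      then have "y - x = 0" by (intro no_rays) (simp add: ray_def)
      then show False using y \<delta> p_scale[of 0 0] by (simp add: B_def)
    qed
    then show "y \<in> \<Union> (out ` {1..})" by (auto simp: out_def)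
  qed
  then obtain \<F> where \<F>: "finite \<F>" "\<F> \<subseteq> out ` {1..}" "B \<subseteq> \<Union>\<F>"
    using compactinD[OF B, of "out ` {1..}"] out_open by blast
  then obtain S where S: "finite S" "S \<subseteq> {1..}" "B \<subseteq> \<Union> (out ` S)"
    using finite_subset_image[OF \<F>(1,2)] by blast
  \<comment> \<open>The inserted 1 covers an empty \<open>S\<close>, which arises when
    \<open>B\<close> is empty.\<close>
  define T where "T = Max (insert 1 S)"
  have T: "T \<ge> 1" "\<And>t. t \<in> S \<Longrightarrow> t \<le> T" using S(1) by (auto simp: T_def)
  have B_out: "ray T y \<notin> C" if y: "y \<in> B" for y
  proof -
    obtain t where "t \<in> S" "ray t y \<notin> C" using S(3) y by (auto simp: out_def)
    then show ?thesis using ray_mono[of T y t] T S(2) by force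
  qed
  have "C \<subseteq> ray T ` Q"
  proof
    fix z assume z: "z \<in> C"
    have pz: "p (z - x) \<le> T * \<delta>"
    proof (rule ccontr)
      assume "\<not> ?thesis"
      then have big: "T * \<delta> < p (z - x)" by simp
      \<comment> \<open>The segment from \<open>x\<close> to \<open>z\<close> crosses
        \<open>B\<close> at factor \<open>s\<close>. Since \<open>T * s < 1\<close>, stretching the
        crossing point by \<open>T\<close> stays on that segment, hence in \<open>C\<close>, against
        \<open>B_out\<close>.\<close>
      define s where "s = \<delta> / p (z - x)"
      have pos: "p (z - x) > 0" using big T(1) \<delta> by (smt (verit) mult_pos_pos)
      have s: "0 < s" "T * s < 1" using big \<delta> pos by (auto simp: s_def field_simps)
      have s1: "s \<le> 1" using s mult_right_mono[OF T(1) less_imp_le[OF s(1)]] by linarith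
      have one: "ray 1 z \<in> C" using z by (simp add: ray_def)
      have "ray s z \<in> C" using ray_mono[OF one, of s] s s1 by simp
      moreover have "p (ray s z - x) = \<delta>"
        using p_scale[of s "z - x"] s pos by (simp add: ray_def s_def)
      ultimately have "ray s z \<in> B" by (simp add: B_def Q_def)
      moreover have "ray T (ray s z) = ray (T * s) z" by (simp add: ray_def)
      moreover have "ray (T * s) z \<in> C" using ray_mono[OF one, of "T * s"] s T(1) by simp
      ultimately show False using B_out by metis
    qed
    have one: "ray 1 z \<in> C" using z by (simp add: ray_def)
    have "p (inverse T *\<^sub>R (z - x)) \<le> \<delta>"
      using T(1) pz p_scale[of "inverse T" "z - x"]
      by (simp add: pos_divide_le_eq inverse_eq_divide mult.commute del: scaleR_right_diff_distrib)
    moreover have "ray (inverse T) z \<in> C"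
      using T(1) by (intro ray_mono[OF one]) (auto simp: field_simps)
    ultimately have "ray (inverse T) z \<in> Q" by (simp add: Q_def ray_def)
    moreover have "z = ray T (ray (inverse T) z)" using T(1) by (simp add: ray_def)
    ultimately show "z \<in> ray T ` Q" by blast
  qed
  then show ?thesis
    using closed_compactin[OF image_compactin[OF Q ray_cont] _ C(2)] by blast
qed

lemma pairing_sum_left: "pairing (sum \<phi> J) y = (\<Sum>j\<in>J. pairing (\<phi> j) y)"
  using linear_sum[of "\<lambda>\<phi>. pairing \<phi> y" \<phi> J]
  by (simp add: linear_iff pairing_simps)

text \<open>
  Each member of a minimal separating subset of \<open>F\<close> is nonzero at some point of \<open>N\<close> where
  all other members vanish.
\<close>

lemma ex_biorthogonal_system:
  assumes N: "subspace N" and F: "finite F"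
    and "\<And>d. d \<in> N \<Longrightarrow> \<forall>\<phi>\<in>F. pairing \<phi> d = 0 \<Longrightarrow> d = 0"
  obtains G e where "finite G" "\<And>d. d \<in> N \<Longrightarrow> \<forall>\<phi>\<in>G. pairing \<phi> d = 0 \<Longrightarrow> d = 0"
    "\<And>\<phi>. \<phi> \<in> G \<Longrightarrow> e \<phi> \<in> N"
    "\<And>\<phi> \<psi>. \<phi> \<in> G \<Longrightarrow> \<psi> \<in> G \<Longrightarrow> pairing \<psi> (e \<phi>) = (if \<psi> = \<phi> then 1 else 0)"
  using F assms(3)
proof (induction F arbitrary: thesis rule: finite_psubset_induct)
  case (psubset F)
  show ?case
  proof (cases "\<exists>\<phi>\<in>F. \<forall>d\<in>N. (\<forall>\<psi>\<in>F - {\<phi>}. pairing \<psi> d = 0) \<longrightarrow> d = 0")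
    case True
    then obtain \<phi> where \<phi>: "\<phi> \<in> F" "\<And>d. d \<in> N \<Longrightarrow> \<forall>\<psi>\<in>F - {\<phi>}. pairing \<psi> d = 0 \<Longrightarrow> d = 0"
      by blast
    then have "F - {\<phi>} \<subset> F" by blast
    then show ?thesis by (rule psubset.IH[OF _ psubset.prems(1) \<phi>(2)])
  next
    case False
    then have "\<forall>\<phi>\<in>F. \<exists>d. d \<in> N \<and> (\<forall>\<psi>\<in>F - {\<phi>}. pairing \<psi> d = 0) \<and> d \<noteq> 0" by blast
    then obtain d where d: "\<And>\<phi>. \<phi> \<in> F \<Longrightarrow> d \<phi> \<in> N" "\<And>\<phi>. \<phi> \<in> F \<Longrightarrow> d \<phi> \<noteq> 0"
      "\<And>\<phi> \<psi>. \<phi> \<in> F \<Longrightarrow> \<psi> \<in> F \<Longrightarrow> \<psi> \<noteq> \<phi> \<Longrightarrow> pairing \<psi> (d \<phi>) = 0"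
      unfolding bchoice_iff by auto
    have nz: "pairing \<phi> (d \<phi>) \<noteq> 0" if \<phi>: "\<phi> \<in> F" for \<phi>
    proof
      assume "pairing \<phi> (d \<phi>) = 0"
      then have "\<forall>\<psi>\<in>F. pairing \<psi> (d \<phi>) = 0" using d(3)[OF \<phi>] by metis
      then show False using psubset.prems(2) d(1,2) \<phi> by blast
    qed
    show ?thesis
    proof (rule psubset.prems(1)[of F "\<lambda>\<phi>. inverse (pairing \<phi> (d \<phi>)) *\<^sub>R d \<phi>"])
      show "finite F" by (rule psubset.hyps)
      show "d = 0" if "d \<in> N" "\<forall>\<phi>\<in>F. pairing \<phi> d = 0" for d
        using psubset.prems(2) that by blast
    qed (use d nz N in \<open>auto simp: pairing_simps subspace_scale\<close>)
  qed
qed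

subsection \<open>Minimizing a robust sum\<close>

text \<open>Translates conjugate domains into slopes of affine minorants, the only form in which
  they are used below.\<close>

lemma conjugate_domain_iff:
  "\<phi> \<in> effective_domain (fenchel_conjugate h) \<longleftrightarrow> (\<exists>\<beta>. \<forall>y. ereal (pairing \<phi> y - \<beta>) \<le> h y)"
proof -
  have swap: "ereal (pairing \<phi> y) - h y \<le> ereal \<beta> \<longleftrightarrow> ereal (pairing \<phi> y - \<beta>) \<le> h y" for y \<beta>
    by (cases "h y") auto
  have "fenchel_conjugate h \<phi> < \<infinity> \<longleftrightarrow> (\<exists>\<beta>. fenchel_conjugate h \<phi> \<le> ereal \<beta>)"
    by (cases "fenchel_conjugate h \<phi>") auto
  then show ?thesis
    by (simp add: effective_domain_def fenchel_conjugate_def SUP_le_iff swap)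
qed

text \<open>Distributes a bound on a partial sum among its terms, so that an affine minorant can be
  chosen for each one. The \<open>c' i\<close> are real even where \<open>g i\<close> is
  infinite.\<close>

lemma less_sum_ereal_obtain:
  fixes g :: "'i \<Rightarrow> ereal"
  assumes "finite J" "\<And>i. i \<in> J \<Longrightarrow> g i \<noteq> - \<infinity>" "ereal c < sum g J"
  shows "\<exists>c'. (\<forall>i\<in>J. ereal (c' i) < g i) \<and> c < sum c' J"
  using assms
proof (induction J arbitrary: c rule: finite_induct)
  case (insert i J)
  have "\<forall>i\<in>J. g i \<noteq> - \<infinity>" using insert.prems(1) by blast
  with insert.hyps(1) have ninf: "sum g J \<noteq> - \<infinity>"
    by (induction J rule: finite_induct) auto
  \<comment> \<open>The non-strict \<open>c \<le> c1 + c2\<close> is enough, as the induction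
    hypothesis strictly exceeds \<open>c2\<close>.\<close>
  have "\<exists>c1 c2. ereal c1 < g i \<and> ereal c2 < sum g J \<and> c \<le> c1 + c2"
  proof (cases "g i")
    case (real v)
    then have "ereal (c - v) < sum g J"
      using insert by (cases "sum g J") auto
    then obtain c2 where c2: "ereal (c - v) < ereal c2" "ereal c2 < sum g J"
      using ereal_dense2 by blast
    then obtain c1 where "c - c2 < c1" "c1 < v"
      using dense[of "c - c2" v] by auto
    with real c2 show ?thesis by (intro exI[of _ c1] exI[of _ c2]) auto
  next
    case PInf
    have "- \<infinity> < sum g J" using ninf by simp
    then obtain c2 where "ereal c2 < sum g J" using ereal_dense2 by blast
    with PInf show ?thesis by (intro exI[of _ "c - c2"] exI[of _ c2]) auto
  next
    case MInf
    then show ?thesis using insert.prems(1)[of i] by simp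
  qed
  then obtain c1 c2 where c12: "ereal c1 < g i" "ereal c2 < sum g J" "c \<le> c1 + c2" by blast
  obtain c' where c': "\<forall>i\<in>J. ereal (c' i) < g i" "c2 < sum c' J"
    using insert.IH[OF insert.prems(1) c12(2)] by auto
  let ?c = "c'(i := c1)"
  have "sum ?c J = sum c' J" using insert.hyps(2) by (intro sum.cong) auto
  then show ?case
    using c12 c' insert.hyps by (intro exI[of _ ?c]) auto
qed simp

lemma conjugate_domain_sumsE:
  assumes "a \<in> conjugate_domain_sums I f"
  obtains \<beta> where "\<And>y. ereal (pairing a y - \<beta>) \<le> robust_sum I f y"
proof -
  obtain J \<phi> where J: "J \<in> finite_nonempty_subsets I" and a: "a = sum \<phi> J"
    and \<phi>: "\<forall>j\<in>J. \<phi> j \<in> effective_domain (fenchel_conjugate (f j))"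
    using assms by (auto simp: conjugate_domain_sums_def finite_nonempty_subsets_def set_sum_alt)
  from \<phi> obtain b where b: "\<And>j y. j \<in> J \<Longrightarrow> ereal (pairing (\<phi> j) y - b j) \<le> f j y"
    unfolding conjugate_domain_iff bchoice_iff by blast
  have "ereal (pairing a y - sum b J) \<le> robust_sum I f y" for y
  proof -
    have "ereal (pairing a y - sum b J) = (\<Sum>j\<in>J. ereal (pairing (\<phi> j) y - b j))"
      by (simp add: a pairing_sum_left sum_subtractf)
    also have "\<dots> \<le> (\<Sum>j\<in>J. f j y)" by (intro sum_mono b)
    also have "\<dots> \<le> robust_sum I f y" unfolding robust_sum_def by (rule SUP_upper[OF J])
    finally show ?thesis .
  qed
  then show ?thesis by (rule that)
qed

text \<open>Some finite partial sum already exceeds \<open>c\<close> at \<open>x\<close>; adding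
  suitable affine minorants of its terms gives the required one.\<close>

lemma robust_sum_affine_minorant:
  assumes f: "\<And>i. i \<in> I \<Longrightarrow> f i \<in> Gamma_class" and c: "ereal c < robust_sum I f x"
  obtains a \<beta> where "a \<in> conjugate_domain_sums I f"
    "\<And>y. ereal (pairing a y - \<beta>) \<le> robust_sum I f y" "c < pairing a x - \<beta>"
proof -
  obtain J where J: "J \<in> finite_nonempty_subsets I" and cJ: "ereal c < (\<Sum>i\<in>J. f i x)"
    using c by (auto simp: robust_sum_def less_SUP_iff)
  then have fin: "finite J" and JI: "J \<subseteq> I" by (auto simp: finite_nonempty_subsets_def)
  have "f i x \<noteq> - \<infinity>" if "i \<in> J" for i
    using f[of i] that JI by (auto simp: Gamma_class_def proper_fun_def)
  then obtain c' where c': "\<And>i. i \<in> J \<Longrightarrow> ereal (c' i) < f i x" "c < sum c' J"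
    using less_sum_ereal_obtain[OF fin _ cJ] by auto
  have "\<exists>\<phi> b. (\<forall>y. ereal (pairing \<phi> y - b) \<le> f j y) \<and> pairing \<phi> x - b = c' j" if "j \<in> J" for j
  proof -
    have "f j \<in> Gamma_class" using f JI that by blast
    then show ?thesis
      using Gamma_class_affine_minorant[where h = "f j" and x = x, OF _ c'(1)[OF that]] by metis
  qed
  then obtain \<phi> b where \<phi>: "\<And>j y. j \<in> J \<Longrightarrow> ereal (pairing (\<phi> j) y - b j) \<le> f j y"
    and val: "\<And>j. j \<in> J \<Longrightarrow> pairing (\<phi> j) x - b j = c' j" by metis
  have "\<forall>j\<in>J. \<phi> j \<in> effective_domain (fenchel_conjugate (f j))"
    using \<phi> unfolding conjugate_domain_iff by blast
  then have "sum \<phi> J \<in> (\<Sum>j\<in>J. effective_domain (fenchel_conjugate (f j)))"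
    using fin by (auto simp: set_sum_alt)
  then have "sum \<phi> J \<in> conjugate_domain_sums I f"
    unfolding conjugate_domain_sums_def using J by blast
  moreover have "ereal (pairing (sum \<phi> J) y - sum b J) \<le> robust_sum I f y" for y
  proof -
    have "ereal (pairing (sum \<phi> J) y - sum b J) = (\<Sum>j\<in>J. ereal (pairing (\<phi> j) y - b j))"
      by (simp add: pairing_sum_left sum_subtractf)
    also have "\<dots> \<le> (\<Sum>j\<in>J. f j y)" by (intro sum_mono \<phi>)
    also have "\<dots> \<le> robust_sum I f y" unfolding robust_sum_def by (rule SUP_upper[OF J])
    finally show ?thesis .
  qed
  moreover have "c < pairing (sum \<phi> J) x - sum b J"
  proof -
    have "sum c' J = pairing (sum \<phi> J) x - sum b J"
      by (simp add: pairing_sum_left flip: sum_subtractf val)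
    with c'(2) show ?thesis by simp
  qed
  ultimately show ?thesis by (rule that)
qed

text \<open>The functionals nonpositive at \<open>d\<close> form a weak-star closed convex cone,
  which therefore contains the given subspace; with \<phi> that subspace contains
  \<open>- \<phi>\<close>.\<close>

lemma polar_of_cone_closure_subspace:
  assumes sub: "subspace (weak_star_topology closure_of cone_gen (convex hull B))"
    and nonpos: "\<And>\<phi>. \<phi> \<in> B \<Longrightarrow> pairing \<phi> d \<le> 0" and \<phi>: "\<phi> \<in> B"
  shows "pairing \<phi> d = 0"
proof -
  let ?V = "weak_star_topology closure_of cone_gen (convex hull B)"
  define H where "H = {\<psi>. pairing \<psi> d \<le> 0}"
  have "convex H"
    by (auto simp: H_def convex_def pairing_simps intro: add_nonpos_nonpos mult_nonneg_nonpos)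
  then have "convex hull B \<subseteq> H" using nonpos by (intro hull_minimal) (auto simp: H_def)
  moreover have "cone H" by (auto simp: H_def cone_def pairing_simps mult_nonneg_nonpos)
  ultimately have "cone_gen (convex hull B) \<subseteq> H"
    unfolding cone_gen_def by (intro hull_minimal) (auto simp: H_def pairing_simps)
  moreover have "closedin weak_star_topology H"
    using closedin_continuous_map_preimage[OF continuous_map_evaluation, of "{..0}" d]
    by (simp add: H_def)
  ultimately have VH: "?V \<subseteq> H" by (rule closure_of_minimal)
  have "\<phi> \<in> cone_gen (convex hull B)"
    unfolding cone_gen_def using \<phi> by (intro hull_inc insertI2)
  then have "\<phi> \<in> ?V"
    using closure_of_subset[of "cone_gen (convex hull B)" weak_star_topology] by auto
  then have "- \<phi> \<in> ?V" by (rule subspace_neg[OF sub])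
  then have "- \<phi> \<in> H" using VH by blast
  then show ?thesis using nonpos[OF \<phi>] by (simp add: H_def pairing_simps)
qed

text \<open>The robust sum enters only through its affine minorants, so the argument is stated for
  any \<open>f\<close> with slopes in a set \<open>A\<close>.\<close>

lemma solution_set_decomposition:
  fixes f :: "'a::locally_convex_hausdorff \<Rightarrow> ereal"
  assumes proper: "proper_fun f" and wlc: "weakly_inf_locally_compact f"
    and minor: "\<And>c x. ereal c < f x \<Longrightarrow>
      \<exists>a\<in>A. \<exists>\<beta>. (\<forall>y. ereal (pairing a y - \<beta>) \<le> f y) \<and> c < pairing a x - \<beta>"
    and below: "\<And>a. a \<in> A \<Longrightarrow> \<exists>\<beta>. \<forall>y. ereal (pairing a y - \<beta>) \<le> f y"
    and sub: "subspace (weak_star_topology closure_of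
      cone_gen (convex hull ((\<lambda>\<phi>. \<phi> - xstar) ` A)))"
  obtains K L where "K \<noteq> {}" "convex K" "compactin weak_topology K"
    "subspace L" "finite_dimensional L" "solution_set f xstar = K + L"
proof -
  \<comment> \<open>The sublevel sets of \<open>f - xstar\<close>, written without extended-real
    subtraction.\<close>
  define S where "S r = {y. f y \<le> ereal (r + pairing xstar y)}" for r
  define P where "P = {(a, \<beta>). a \<in> A \<and> (\<forall>y. ereal (pairing a y - \<beta>) \<le> f y)}"
  have S_iff: "y \<in> S r \<longleftrightarrow> (\<forall>(a, \<beta>)\<in>P. pairing (a - xstar) y \<le> r + \<beta>)" for y r
  proof
    assume y: "y \<in> S r"
    show "\<forall>(a, \<beta>)\<in>P. pairing (a - xstar) y \<le> r + \<beta>"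
    proof clarify
      fix a \<beta> assume "(a, \<beta>) \<in> P"
      then have "ereal (pairing a y - \<beta>) \<le> f y" by (simp add: P_def)
      also have "\<dots> \<le> ereal (r + pairing xstar y)" using y by (simp add: S_def)
      finally show "pairing (a - xstar) y \<le> r + \<beta>" by (simp add: pairing_simps)
    qed
  next
    assume all: "\<forall>(a, \<beta>)\<in>P. pairing (a - xstar) y \<le> r + \<beta>"
    show "y \<in> S r"
    proof (rule ccontr)
      assume "y \<notin> S r"
      then have "ereal (r + pairing xstar y) < f y" by (simp add: S_def)
      from minor[OF this] obtain a \<beta> where "(a, \<beta>) \<in> P" "r + pairing xstar y < pairing a y - \<beta>"
        by (auto simp: P_def)
      with all show False by (fastforce simp: pairing_simps)
    qed
  qed
  have S_eq: "S r = \<Inter> (insert UNIV ((\<lambda>(a, \<beta>). {y. pairing (a - xstar) y \<le> r + \<beta>}) ` P))" for r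
    using S_iff by fastforce
  have S_closed: "closedin weak_topology (S r)" for r
    unfolding S_eq
    using closedin_topspace[of "weak_topology :: 'a topology"] closedin_weak_halfspace
    by (intro closedin_Inter) auto
  have "convex {y. pairing \<phi> y \<le> b}" for \<phi> :: "'a dual" and b
    by (auto intro!: convexI convex_bound_le simp: pairing_simps)
  then have S_convex: "convex (S r)" for r
    unfolding S_eq by (intro convex_Inter) auto
  have S_mono: "S r \<subseteq> S s" if "r \<le> s" for r s
    using that by (force simp: S_iff)

  define N where "N = {d. \<forall>a\<in>A. pairing (a - xstar) d = 0}"
  have N: "subspace N"
    by (auto simp: N_def subspace_def pairing_simps simp flip: minus_dual.rep_eq)
  have S_N: "y + d \<in> S r" if "y \<in> S r" "d \<in> N" for y d r
  proof -
    have "pairing (a - xstar) (y + d) = pairing (a - xstar) y" if "(a, \<beta>) \<in> P" for a \<beta>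
      using that \<open>d \<in> N\<close> linear_add[OF linear_pairing, of "a - xstar" y d] by (auto simp: N_def P_def)
    then show ?thesis using that(1) unfolding S_iff by fastforce
  qed
  have recession: "d \<in> N" if ray: "\<And>t. 0 \<le> t \<Longrightarrow> x + t *\<^sub>R d \<in> S r" for x d r
  proof -
    have nonpos: "pairing (a - xstar) d \<le> 0" if a: "a \<in> A" for a
    proof (rule ccontr)
      assume "\<not> ?thesis"
      then have pos: "pairing (a - xstar) d > 0" by simp
      obtain \<beta> where "(a, \<beta>) \<in> P" using below[OF a] a by (auto simp: P_def)
      then have bd: "pairing (a - xstar) x + t * pairing (a - xstar) d \<le> r + \<beta>" if "0 \<le> t" for t
        using ray[OF that] linear_add[OF linear_pairing, of "a - xstar" x "t *\<^sub>R d"]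
          linear_cmul[OF linear_pairing, of "a - xstar" t d] unfolding S_iff by auto
      \<comment> \<open>At this time the growth along the ray is at least 1 more than the bound
        allows.\<close>
      define u where "u = (\<bar>r + \<beta> - pairing (a - xstar) x\<bar> + 1) / pairing (a - xstar) d"
      have "u \<ge> 0" using pos by (simp add: u_def)
      from bd[OF this] pos show False by (simp add: u_def)
    qed
    show ?thesis
      unfolding N_def using polar_of_cone_closure_subspace[OF sub, of d] nonpos by auto
  qed

  have S_locally_compact:
    "\<exists>U K. openin weak_topology U \<and> x \<in> U \<and> compactin weak_topology K \<and> S r \<inter> U \<subseteq> K"
    if x: "x \<in> S r" for x r
  proof -
    \<comment> \<open>On the open half-space \<open>W\<close> below, \<open>xstar\<close> grows by
      less than 1 over its value at \<open>x\<close>, so there \<open>S r\<close> lies in the level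
      set of \<open>f\<close> at \<open>r'\<close>, which is locally compact by hypothesis.\<close>
    define r' where "r' = r + pairing xstar x + 1"
    have "f x \<le> ereal (r + pairing xstar x)" using x by (simp add: S_def)
    also have "\<dots> \<le> ereal r'" by (simp add: r'_def)
    finally have xr': "x \<in> topspace (subtopology weak_topology {y. f y \<le> ereal r'})" by simp
    have "locally_compact_space (subtopology weak_topology {y. f y \<le> ereal r'})"
      using wlc by (simp add: weakly_inf_locally_compact_def)
    with xr' obtain U' K where U': "openin (subtopology weak_topology {y. f y \<le> ereal r'}) U'"
      and K: "compactin (subtopology weak_topology {y. f y \<le> ereal r'}) K" "x \<in> U'" "U' \<subseteq> K"
      unfolding locally_compact_space_def by meson
    from U' obtain U where U: "openin weak_topology U" "U' = U \<inter> {y. f y \<le> ereal r'}"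
      by (auto simp: openin_subtopology)
    define W where "W = {y. pairing xstar y < pairing xstar x + 1}"
    have W: "openin weak_topology W"
      using openin_continuous_map_preimage[OF continuous_map_pairing, of "{..<pairing xstar x + 1}" xstar]
      by (simp add: W_def)
    have "S r \<inter> (U \<inter> W) \<subseteq> K"
    proof
      fix y assume y: "y \<in> S r \<inter> (U \<inter> W)"
      then have "f y \<le> ereal (r + pairing xstar y)" by (simp add: S_def)
      also have "\<dots> \<le> ereal r'" using y by (simp add: W_def r'_def)
      finally show "y \<in> K" using y U(2) K(3) by blast
    qed
    moreover have "x \<in> U \<inter> W" using K(2) U(2) by (simp add: W_def)
    moreover have "compactin weak_topology K" using K(1) by (simp add: compactin_subtopology)
    ultimately show ?thesis using openin_Int[OF U(1) W] by blast
  qed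

  obtain x0 where "f x0 < \<infinity>" using proper by (auto simp: proper_fun_def effective_domain_def)
  moreover have ninf: "f y \<noteq> - \<infinity>" for y using proper by (simp add: proper_fun_def)
  ultimately obtain v where v: "f x0 = ereal v" by (cases "f x0") auto
  define r0 where "r0 = v - pairing xstar x0"
  have x0: "x0 \<in> S r0" by (simp add: S_def r0_def v)

  obtain U K where UK: "openin weak_topology U" "x0 \<in> U" "compactin weak_topology K" "S r0 \<inter> U \<subseteq> K"
    using S_locally_compact[OF x0] by blast
  obtain F \<epsilon> where F: "finite F" "\<epsilon> > 0" "{y. \<forall>\<phi>\<in>F. \<bar>pairing \<phi> (y - x0)\<bar> < \<epsilon>} \<subseteq> U"
    using weak_neighbourhood_base[OF UK(1,2)] by blast
  \<comment> \<open>Such a \<open>d\<close> would keep the entire line through \<open>x0\<close>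
    inside the weakly compact \<open>K\<close>, where every functional is bounded.\<close>
  have F_N: "d = 0" if d: "d \<in> N" "\<forall>\<phi>\<in>F. pairing \<phi> d = 0" for d
  proof (rule dual_separates_zero)
    fix \<psi>
    have line: "x0 + t *\<^sub>R d \<in> K" for t
    proof -
      have "x0 + t *\<^sub>R d \<in> S r0" using S_N[OF x0] d(1) N by (simp add: subspace_scale)
      moreover have "x0 + t *\<^sub>R d \<in> U" using F(2,3) d(2) by (auto simp: pairing_simps subset_iff)
      ultimately show ?thesis using UK(4) by blast
    qed
    obtain b where "\<And>y. y \<in> K \<Longrightarrow> \<bar>pairing \<psi> y\<bar> \<le> b"
      using bounded_pairing_of_weakly_compact[OF UK(3)] by blast
    then have b: "\<bar>pairing \<psi> x0 + t * pairing \<psi> d\<bar> \<le> b" for t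
      using line[of t] by (force simp: pairing_simps)
    show "pairing \<psi> d = 0"
    proof (rule ccontr)
      assume "pairing \<psi> d \<noteq> 0"
      with b[of "(\<bar>b\<bar> + 1 - pairing \<psi> x0) / pairing \<psi> d"] show False by simp
    qed
  qed
  obtain G e where G: "finite G" "\<And>d. d \<in> N \<Longrightarrow> \<forall>\<phi>\<in>G. pairing \<phi> d = 0 \<Longrightarrow> d = 0"
    "\<And>\<phi>. \<phi> \<in> G \<Longrightarrow> e \<phi> \<in> N"
    "\<And>\<phi> \<psi>. \<phi> \<in> G \<Longrightarrow> \<psi> \<in> G \<Longrightarrow> pairing \<psi> (e \<phi>) = (if \<psi> = \<phi> then 1 else 0)"
    by (rule ex_biorthogonal_system[OF N F(1) F_N]) blast+
  \<comment> \<open>By biorthogonality \<open>R\<close> is the projection onto \<open>N\<close>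
    along \<open>M\<close>.\<close>
  define M where "M = {y. \<forall>\<phi>\<in>G. pairing \<phi> y = 0}"
  define R where "R y = (\<Sum>\<phi>\<in>G. pairing \<phi> y *\<^sub>R e \<phi>)" for y
  have R_N: "R y \<in> N" for y
    unfolding R_def using N G(3) by (intro subspace_sum subspace_scale)
  have R_M: "y - R y \<in> M" for y
    by (auto simp: M_def R_def pairing_simps G(1,4) if_distrib cong: if_cong)
  have R_id: "R d = d" if "d \<in> N" for d
    using G(2)[of "d - R d"] R_M[of d] R_N[of d] that N by (simp add: M_def subspace_diff)
  have "N = span (e ` G)"
  proof
    show "N \<subseteq> span (e ` G)"
    proof
      fix d assume "d \<in> N"
      then have "d = R d" by (simp add: R_id)
      also have "R d \<in> span (e ` G)"
        unfolding R_def by (intro span_sum span_scale span_base imageI)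
      finally show "d \<in> span (e ` G)" .
    qed
    show "span (e ` G) \<subseteq> N" using G(3) N by (intro span_minimal) auto
  qed
  then have N_fin: "finite_dimensional N"
    unfolding finite_dimensional_def using G(1) by blast
  have M_closed: "closedin weak_topology M"
    unfolding M_def by (rule closedin_weak_kernel)
  have "subspace M" by (auto simp: M_def subspace_def pairing_simps)
  then have M_convex: "convex M" by (rule subspace_imp_convex)
  have proj: "y - R y \<in> S r \<inter> M" if "y \<in> S r" for y r
    using S_N[OF that, of "- R y"] R_N[of y] R_M[of y] N by (simp add: subspace_neg)
  have S_decomp: "S r = (S r \<inter> M) + N" for r
  proof
    show "S r \<subseteq> (S r \<inter> M) + N"
    proof
      fix y assume "y \<in> S r"
      from set_plus_intro[OF proj[OF this] R_N[of y]] show "y \<in> (S r \<inter> M) + N" by simp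
    qed
    show "(S r \<inter> M) + N \<subseteq> S r" using S_N by (auto simp: set_plus_def)
  qed

  define C where "C = S r0 \<inter> M"
  define x1 where "x1 = x0 - R x0"
  have x1: "x1 \<in> C" unfolding C_def x1_def by (rule proj[OF x0])
  have C_compact: "compactin weak_topology C"
  proof -
    obtain U K where UK: "openin weak_topology U" "x1 \<in> U" "compactin weak_topology K" "S r0 \<inter> U \<subseteq> K"
      using S_locally_compact[of x1 r0] x1 by (auto simp: C_def)
    show ?thesis
    proof (rule weakly_compact_of_no_rays[OF _ _ x1 UK(1-3)])
      show "convex C" unfolding C_def using S_convex M_convex by (rule convex_Int)
      show "closedin weak_topology C" unfolding C_def using S_closed M_closed by (rule closedin_Int)
      show "C \<inter> U \<subseteq> K" using UK(4) by (auto simp: C_def)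
      fix d assume ray: "\<And>t. 0 \<le> t \<Longrightarrow> x1 + t *\<^sub>R d \<in> C"
      then have "d \<in> N" by (intro recession[of x1 d r0]) (auto simp: C_def)
      moreover have "pairing \<phi> d = 0" if "\<phi> \<in> G" for \<phi>
        \<comment> \<open>Both \<open>x1\<close> and \<open>x1 + d\<close> lie in \<open>M\<close>,
          hence so does \<open>d\<close>.\<close>
        using ray[of 1] x1 that by (auto simp: C_def M_def pairing_simps)
      ultimately show "d = 0" using G(2) by blast
    qed
  qed

  define g where "g y = f y - ereal (pairing xstar y)" for y
  have S_g: "y \<in> S r \<longleftrightarrow> g y \<le> ereal r" for y r
    using ninf[of y] by (cases "f y") (auto simp: S_def g_def)
  have "\<exists>y\<in>C. \<forall>z. g y \<le> g z"
  proof (rule ccontr)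
    assume contra: "\<not> ?thesis"
    \<comment> \<open>Without a minimizer in \<open>C\<close>, the complements of the nonempty
      sublevel sets cover \<open>C\<close>. These sets are nested, so a finite subcover fails at a
      point of the lowest one, projected into \<open>M\<close>.\<close>
    define \<S> where "\<S> = {s. S s \<noteq> {}}"
    have "C \<subseteq> \<Union> ((\<lambda>s. - S s) ` \<S>)"
    proof
      fix y assume "y \<in> C"
      then obtain z where "g z < g y" using contra by (auto simp: not_le)
      then obtain s where s: "g z < ereal s" "ereal s < g y" using ereal_dense2 by blast
      then have "z \<in> S s" "y \<notin> S s" by (simp_all add: S_g)
      then show "y \<in> \<Union> ((\<lambda>s. - S s) ` \<S>)" by (auto simp: \<S>_def)
    qed
    moreover have "openin weak_topology (- S s)" for s
      using S_closed[of s] by (simp add: closedin_def Compl_eq_Diff_UNIV)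
    ultimately obtain \<F> where \<F>: "finite \<F>" "\<F> \<subseteq> (\<lambda>s. - S s) ` \<S>" "C \<subseteq> \<Union> \<F>"
      using compactinD[OF C_compact, of "(\<lambda>s. - S s) ` \<S>"] by blast
    then obtain T where T: "finite T" "T \<subseteq> \<S>" "C \<subseteq> (\<Union>s\<in>T. - S s)"
      using finite_subset_image[OF \<F>(1,2)] by blast
    \<comment> \<open>Including \<open>r0\<close> puts the projected point into \<open>C\<close> and
      covers an empty \<open>T\<close>.\<close>
    define s0 where "s0 = Min (insert r0 T)"
    have s0: "s0 \<le> r0" "\<And>s. s \<in> T \<Longrightarrow> s0 \<le> s" using T(1) by (auto simp: s0_def)
    have "s0 \<in> insert r0 T" unfolding s0_def using T(1) by (intro Min_in) auto
    then obtain y where "y \<in> S s0" using T(2) x0 by (auto simp: \<S>_def)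
    then have y: "y - R y \<in> S s0 \<inter> M" by (rule proj)
    then have "y - R y \<in> C" using S_mono[OF s0(1)] by (auto simp: C_def)
    then obtain s where "s \<in> T" "y - R y \<notin> S s" using T(3) by blast
    then show False using y S_mono[OF s0(2)] by blast
  qed
  then obtain y where y: "y \<in> C" "\<And>z. g y \<le> g z" by blast
  have "g y \<le> ereal r0" using y(1) by (simp add: C_def S_g)
  moreover have "g y \<noteq> - \<infinity>" using ninf[of y] by (cases "f y") (auto simp: g_def)
  ultimately obtain m where m: "g y = ereal m" by (cases "g y") auto
  have "(INF z. g z) = ereal m"
    using y(2) m by (intro antisym INF_greatest) (auto intro: INF_lower2[of y])
  then have sol: "solution_set f xstar = S m"
    using y(2) m by (auto simp: solution_set_def S_g simp flip: g_def intro: antisym)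
  have "m \<le> r0" using \<open>g y \<le> ereal r0\<close> m by simp
  show ?thesis
  proof (rule that)
    have "y \<in> S m" by (simp add: S_g m)
    then show "S m \<inter> M \<noteq> {}" using y(1) by (auto simp: C_def)
    show "convex (S m \<inter> M)" using S_convex M_convex by (rule convex_Int)
    show "compactin weak_topology (S m \<inter> M)"
      using S_mono[OF \<open>m \<le> r0\<close>] S_closed M_closed
      by (intro closed_compactin[OF C_compact] closedin_Int) (auto simp: C_def)
    show "solution_set f xstar = (S m \<inter> M) + N" using sol S_decomp by simp
  qed (fact N N_fin)+
qed

theorem theorem3p1:
  fixes I :: "'i set"
    and f :: "'i \<Rightarrow> 'a::locally_convex_hausdorff \<Rightarrow> ereal"
    and xstar :: "'a dual"
  assumes "infinite I"
    and "\<And>i. i \<in> I \<Longrightarrow> f i \<in> Gamma_class"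
    and "proper_fun (robust_sum I f)"
    and "weakly_inf_locally_compact (robust_sum I f)"
    and "subspace (weak_star_topology closure_of
           cone_gen (convex hull ((\<lambda>\<phi>. \<phi> - xstar) ` conjugate_domain_sums I f)))"
  shows "solution_set (robust_sum I f) xstar \<noteq> {}
    \<and> (\<exists>K L. K \<noteq> {} \<and> convex K \<and> compactin weak_topology K
          \<and> subspace L \<and> finite_dimensional L
          \<and> solution_set (robust_sum I f) xstar = K + L)"
proof -
  have minor: "\<exists>a\<in>conjugate_domain_sums I f. \<exists>\<beta>.
      (\<forall>y. ereal (pairing a y - \<beta>) \<le> robust_sum I f y) \<and> c < pairing a x - \<beta>"
    if "ereal c < robust_sum I f x" for c x
    using robust_sum_affine_minorant[OF assms(2) that] by blast
  have below: "\<exists>\<beta>. \<forall>y. ereal (pairing a y - \<beta>) \<le> robust_sum I f y"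
    if "a \<in> conjugate_domain_sums I f" for a
    using conjugate_domain_sumsE[OF that] by blast
  obtain K L where KL: "K \<noteq> {}" "convex K" "compactin weak_topology K"
    "subspace L" "finite_dimensional L" "solution_set (robust_sum I f) xstar = K + L"
    by (rule solution_set_decomposition[OF assms(3,4) minor below assms(5)])
  moreover have "K + L \<noteq> {}"
    using KL(1) subspace_0[OF KL(4)] by (auto simp: set_plus_def)
  ultimately show ?thesis by metis
qed

end
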